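(* Let $d$ be a positive integer, let $G=(V,E)$ be a finite graph and let $f_E:E\to\mathbb{Z}_d$ be an e-labeling of $G$. Then $(G,f_E)$ is additive if and only if it is compatible.
   Context: $\mathbb{Z}_d$ denotes the integers modulo $d$. An e-labeling is a map $f_E:E\to\mathbb{Z}_d$ and a v-labeling is a map $f_V:V\to\mathbb{Z}_d$. A v-labeling $f_V$ is a valid v-labeling of $(G,f_E)$ if $f_E((v,v'))\equiv f_V(v)+f_V(v') \pmod d$ for every edge $(v,v')\in E$; $(G,f_E)$ (or $f_E$) is called additive if a valid v-labeling exists. A cycle of length $k$ is a closed walk, not necessarily simple: vertices $v_1,\dots,v_k$ (repetitions allowed) and edges $e_1,\dots,e_k$ with $e_i=(v_i,v_{i+1})$ for $i<k$ and $e_k=(v_k,v_1)$ (edges may repeat). $(G,f_E)$ has the even cycle property if every cycle of even length, with edges $e_1,\dots,e_{2k}$, satisfies $\sum_{l\text{ odd}} f_E(e_l)\equiv\sum_{l\text{ even}} f_E(e_l)\pmod d$. For $d$ even, $(G,f_E)$ has the odd cycle property if every cycle of odd length, with edges $e_1,\dots,e_{2k+1}$, satisfies $\frac d2\sum_{l=1}^{2k+1} f_E(e_l)\equiv 0\pmod d$ (equivalently, the sum of the labels, taken as integers in $\{0,\dots,d-1\}$, is even). $(G,f_E)$ is compatible if either $d$ is odd and $(G,f_E)$ has the even cycle property, or $d$ is even and $(G,f_E)$ has both the even and the odd cycle properties. *)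

theory Defs
  imports "HOL-Number_Theory.Cong" "HOL-Library.FuncSet"
begin

text \<open>
  An undirected edge with endpoints \<open>u\<close> and \<open>v\<close> is the set \<open>{u, v}\<close>; a loop is the case
  \<open>u = v\<close>. So there are no parallel edges, and loops are allowed (simple graphs are a special case).
\<close>

definition finite_graph :: "'v set \<Rightarrow> 'v set set \<Rightarrow> bool" where
  "finite_graph V E \<longleftrightarrow> finite V \<and> E \<subseteq> {{u, v} | u v. u \<in> V \<and> v \<in> V}"

text \<open>
  The integers modulo \<open>d\<close> are represented by \<open>{0..<d}\<close>, with equations read as congruences
  modulo \<open>d\<close>. Values of a labeling outside \<open>E\<close> or \<open>V\<close> are irrelevant.
\<close>

definition e_labeling :: "int \<Rightarrow> 'v set set \<Rightarrow> ('v set \<Rightarrow> int) \<Rightarrow> bool" where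
  "e_labeling d E fE \<longleftrightarrow> fE \<in> E \<rightarrow> {0..<d}"

definition v_labeling :: "int \<Rightarrow> 'v set \<Rightarrow> ('v \<Rightarrow> int) \<Rightarrow> bool" where
  "v_labeling d V fV \<longleftrightarrow> fV \<in> V \<rightarrow> {0..<d}"

definition valid_v_labeling ::
    "int \<Rightarrow> 'v set \<Rightarrow> 'v set set \<Rightarrow> ('v set \<Rightarrow> int) \<Rightarrow> ('v \<Rightarrow> int) \<Rightarrow> bool" where
  "valid_v_labeling d V E fE fV \<longleftrightarrow>
     v_labeling d V fV \<and> (\<forall>u v. {u, v} \<in> E \<longrightarrow> [fE {u, v} = fV u + fV v] (mod d))"

definition additive :: "int \<Rightarrow> 'v set \<Rightarrow> 'v set set \<Rightarrow> ('v set \<Rightarrow> int) \<Rightarrow> bool" where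
  "additive d V E fE \<longleftrightarrow> (\<exists>fV. valid_v_labeling d V E fE fV)"

text \<open>
  A cycle is a closed walk; neither vertices nor edges need be distinct. In the notation
  \<open>v\<^sub>1, \<dots>, v\<^sub>k\<close> and \<open>e\<^sub>1, \<dots>, e\<^sub>k\<close>, the vertex \<open>v\<^sub>l\<close> is \<open>vs ! (l - 1)\<close> and the edge \<open>e\<^sub>l\<close> is
  \<open>es ! (l - 1)\<close>; the \<open>mod\<close> closes the walk by \<open>e\<^sub>k = {v\<^sub>k, v\<^sub>1}\<close>. For \<open>k = 1\<close> the edge is a loop.
\<close>

definition is_cycle :: "'v set \<Rightarrow> 'v set set \<Rightarrow> 'v list \<Rightarrow> 'v set list \<Rightarrow> bool" where
  "is_cycle V E vs es \<longleftrightarrow>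
     es \<noteq> [] \<and> length vs = length es \<and> set vs \<subseteq> V \<and> set es \<subseteq> E \<and>
     (\<forall>i < length es. es ! i = {vs ! i, vs ! (Suc i mod length es)})"

definition even_cycle_property :: "int \<Rightarrow> 'v set \<Rightarrow> 'v set set \<Rightarrow> ('v set \<Rightarrow> int) \<Rightarrow> bool" where
  "even_cycle_property d V E fE \<longleftrightarrow>
     (\<forall>vs es. is_cycle V E vs es \<and> even (length es) \<longrightarrow>
        [(\<Sum>l | l \<in> {1..length es} \<and> odd l. fE (es ! (l - 1))) =
         (\<Sum>l | l \<in> {1..length es} \<and> even l. fE (es ! (l - 1)))] (mod d))"

text \<open>Only meaningful for even \<open>d\<close>, where \<open>d div 2\<close> is the exact half.\<close>

definition odd_cycle_property :: "int \<Rightarrow> 'v set \<Rightarrow> 'v set set \<Rightarrow> ('v set \<Rightarrow> int) \<Rightarrow> bool" where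
  "odd_cycle_property d V E fE \<longleftrightarrow>
     (\<forall>vs es. is_cycle V E vs es \<and> odd (length es) \<longrightarrow>
        [d div 2 * (\<Sum>l = 1..length es. fE (es ! (l - 1))) = 0] (mod d))"

definition compatible :: "int \<Rightarrow> 'v set \<Rightarrow> 'v set set \<Rightarrow> ('v set \<Rightarrow> int) \<Rightarrow> bool" where
  "compatible d V E fE \<longleftrightarrow>
     (odd d \<and> even_cycle_property d V E fE) \<or>
     (even d \<and> even_cycle_property d V E fE \<and> odd_cycle_property d V E fE)"

end

(* A valid v-labeling propagates along a walk: if s is the alternating sum of the n labels met
   on a walk from u to v, the last label counted positively, then f(v) = s + (-1)^n f(u).
   So the whole labeling of a component is determined by its value a at a root, and the only
   obstructions come from closed walks: an even one forces s = 0, an odd one forces 2 a = s.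
   The even cycle property gives the former and makes all the latter equations agree; the
   equation 2 a = s is solvable modulo odd d always, and modulo even d iff s is even, which is
   the odd cycle property because signs do not matter modulo 2. *)

theory Submission
  imports Defs
begin

text \<open>Indices start at 0, so the odd-numbered edges of a cycle count positively.\<close>

definition alternating_sum :: "('e \<Rightarrow> int) \<Rightarrow> 'e list \<Rightarrow> int" where
  "alternating_sum f es = (\<Sum>i<length es. (-1) ^ i * f (es ! i))"

lemma sum_odd_minus_sum_even:
  fixes g :: "nat \<Rightarrow> int"
  shows "(\<Sum>l | l \<in> {1..n} \<and> odd l. g (l - 1)) - (\<Sum>l | l \<in> {1..n} \<and> even l. g (l - 1)) =
    (\<Sum>i<n. (-1) ^ i * g i)"
proof (induction n)
  case (Suc n)
  have *: "{l. Suc 0 \<le> l \<and> l \<le> Suc n \<and> P l} =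
      (if P (Suc n) then insert (Suc n) {l. Suc 0 \<le> l \<and> l \<le> n \<and> P l}
       else {l. Suc 0 \<le> l \<and> l \<le> n \<and> P l})" for P
    by (auto simp: le_Suc_eq)
  show ?case
    using Suc.IH by (cases "even n") (simp_all add: *)
qed simp

lemma even_cycle_property_iff:
  "even_cycle_property d V E fE \<longleftrightarrow>
    (\<forall>vs es. is_cycle V E vs es \<and> even (length es) \<longrightarrow> [alternating_sum fE es = 0] (mod d))"
  unfolding even_cycle_property_def alternating_sum_def
    sum_odd_minus_sum_even[of "\<lambda>i. fE (es ! i)" for es, symmetric]
  by (simp add: cong_iff_dvd_diff)

lemma even_alternating_sum: "even (alternating_sum f es) \<longleftrightarrow> even (\<Sum>i<length es. f (es ! i))"
proof -
  have "even (\<Sum>i<n. (-1) ^ i * f (es ! i)) \<longleftrightarrow> even (\<Sum>i<n. f (es ! i))" for n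
    by (induction n) auto
  then show ?thesis
    by (simp add: alternating_sum_def)
qed

lemma odd_cycle_property_iff:
  assumes "d > 0" "even d"
  shows "odd_cycle_property d V E fE \<longleftrightarrow>
    (\<forall>vs es. is_cycle V E vs es \<and> odd (length es) \<longrightarrow> even (alternating_sum fE es))"
proof -
  obtain c where c: "d = 2 * c" "c > 0"
    using assms by (auto elim: evenE)
  \<comment> \<open>\<open>c\<close> cancels: \<open>2 * c\<close> divides \<open>c * s\<close> iff
    2 divides \<open>s\<close>.\<close>
  have "[d div 2 * s = 0] (mod d) \<longleftrightarrow> even s" for s
    using c by (simp add: cong_0_iff mult.commute)
  moreover have "(\<Sum>l = 1..length es. fE (es ! (l - 1))) = (\<Sum>i<length es. fE (es ! i))" for es
    by (simp add: sum.atLeast1_atMost_eq)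
  ultimately show ?thesis
    unfolding odd_cycle_property_def by (simp only: even_alternating_sum)
qed

text \<open>With \<open>z i = (-1) ^ i * y i\<close> the summand is
  \<open>z i - z (Suc i)\<close>.\<close>

lemma alternating_sum_telescope:
  fixes y :: "nat \<Rightarrow> int"
  shows "(\<Sum>i<n. (-1) ^ i * (y i + y (Suc i))) = y 0 - (-1) ^ n * y n"
  by (induction n) (simp_all add: algebra_simps)

lemma alternating_sum_cycle:
  assumes "is_cycle V E vs es" "valid_v_labeling d V E fE fV"
  shows "[alternating_sum fE es = (1 - (-1) ^ length es) * fV (vs ! 0)] (mod d)"
proof -
  let ?n = "length es"
  \<comment> \<open>The \<open>mod\<close> gives \<open>y ?n = y 0\<close>, so the two ends of the
    telescoped sum are the same label.\<close>
  define y where "y i = fV (vs ! (i mod ?n))" for i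
  have "[fE (es ! i) = y i + y (Suc i)] (mod d)" if "i < ?n" for i
  proof -
    have "es ! i = {vs ! i, vs ! (Suc i mod ?n)}" "es ! i \<in> E"
      using assms(1) that nth_mem[OF that] by (auto simp: is_cycle_def simp del: nth_mem)
    then show ?thesis
      using assms(2) that unfolding valid_v_labeling_def y_def by (metis mod_less)
  qed
  then have "[alternating_sum fE es = (\<Sum>i<?n. (-1) ^ i * (y i + y (Suc i)))] (mod d)"
    unfolding alternating_sum_def by (intro cong_sum cong_mult cong_refl) auto
  then show ?thesis
    unfolding alternating_sum_telescope by (simp add: y_def algebra_simps)
qed

lemma additive_imp_compatible:
  assumes "d > 0" "additive d V E fE"
  shows "compatible d V E fE"
proof -
  obtain fV where valid: "valid_v_labeling d V E fE fV"
    using assms(2) by (auto simp: additive_def)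
  have "even_cycle_property d V E fE"
    using alternating_sum_cycle[OF _ valid] by (fastforce simp: even_cycle_property_iff)
  moreover have "odd_cycle_property d V E fE" if "even d"
  proof -
    have "even (alternating_sum fE es)" if "is_cycle V E vs es" "odd (length es)" for vs es
    proof -
      have "[alternating_sum fE es = 2 * fV (vs ! 0)] (mod d)"
        using alternating_sum_cycle[OF that(1) valid] that(2) by simp
      then have "[alternating_sum fE es = 2 * fV (vs ! 0)] (mod 2)"
        using \<open>even d\<close> by (rule cong_dvd_modulus)
      then show ?thesis
        by (simp add: cong_dvd_iff)
    qed
    then show ?thesis
      using assms(1) \<open>even d\<close> by (auto simp: odd_cycle_property_iff)
  qed
  ultimately show ?thesis
    by (auto simp: compatible_def)
qed

text \<open>
  \<open>walk E f u n s v\<close>: some walk of length \<open>n\<close> from \<open>u\<close> to \<open>v\<close> forces any vertex labeling \<open>x\<close>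
  inducing \<open>f\<close> to satisfy \<open>x v = s + (-1) ^ n * x u\<close>.
\<close>

inductive walk :: "'v set set \<Rightarrow> ('v set \<Rightarrow> int) \<Rightarrow> 'v \<Rightarrow> nat \<Rightarrow> int \<Rightarrow> 'v \<Rightarrow> bool"
  for E f u where
    nil: "walk E f u 0 0 u"
  | snoc: "walk E f u n s v \<Longrightarrow> {v, w} \<in> E \<Longrightarrow> walk E f u (Suc n) (f {v, w} - s) w"

text \<open>Substitutes \<open>x v = s + (-1) ^ n * x u\<close> into
  \<open>x w = t + (-1) ^ m * x v\<close>. The later walk comes first since the induction runs over
  it.\<close>

lemma walk_append:
  assumes "walk E f v m t w" "walk E f u n s v"
  shows "walk E f u (n + m) (t + (-1) ^ m * s) w"
  using assms
proof (induction rule: walk.induct)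
  case (snoc m t v' w)
  from walk.snoc[OF snoc.IH[OF snoc.prems] snoc.hyps(2)] show ?case
    by (simp add: algebra_simps)
qed simp

text \<open>Solves \<open>x v = s + (-1) ^ n * x u\<close> for \<open>x u\<close>.\<close>

lemma walk_reverse:
  assumes "walk E f u n s v"
  shows "walk E f v n (- ((-1) ^ n * s)) u"
  using assms
proof (induction rule: walk.induct)
  case (snoc n s v w)
  have "walk E f w (Suc 0) (f {w, v} - 0) v"
    using snoc.hyps(2) by (intro walk.snoc walk.nil) (simp add: insert_commute)
  from walk_append[OF snoc.IH this] show ?case
    by (simp add: algebra_simps insert_commute)
qed (simp add: walk.nil)

text \<open>A walk counts its last label positively, so label \<open>i\<close> has sign
  \<open>(-1) ^ (n - 1 - i)\<close>; the factor \<open>- ((-1) ^ n)\<close> converts this to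
  \<open>(-1) ^ i\<close>.\<close>

lemma walk_vertices:
  assumes "walk E f u n s v"
  shows "\<exists>p. p 0 = u \<and> p n = v \<and> (\<forall>i<n. {p i, p (Suc i)} \<in> E) \<and>
    s = - ((-1) ^ n * (\<Sum>i<n. (-1) ^ i * f {p i, p (Suc i)}))"
  using assms
proof (induction rule: walk.induct)
  case nil
  show ?case by (intro exI[of _ "\<lambda>_. u"]) simp
next
  case (snoc n s v w)
  then obtain p where p: "p 0 = u" "p n = v" "\<forall>i<n. {p i, p (Suc i)} \<in> E"
      "s = - ((-1) ^ n * (\<Sum>i<n. (-1) ^ i * f {p i, p (Suc i)}))"
    by blast
  define q where "q = p(Suc n := w)"
  have "(\<Sum>i<n. (-1) ^ i * f {q i, q (Suc i)}) = (\<Sum>i<n. (-1) ^ i * f {p i, p (Suc i)})"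
    by (intro sum.cong) (auto simp: q_def)
  moreover have "{q i, q (Suc i)} \<in> E" if "i < Suc n" for i
    using that p snoc.hyps(2) by (cases "i = n") (auto simp: q_def)
  ultimately show ?case
    using p by (intro exI[of _ q]) (simp add: q_def algebra_simps flip: power_mult_distrib)
qed

lemma closed_walk_cycle:
  assumes "walk E f u n s u" "n > 0" "E \<subseteq> {{u, v} | u v. u \<in> V \<and> v \<in> V}"
  shows "\<exists>vs es. is_cycle V E vs es \<and> length es = n \<and> s = - ((-1) ^ n * alternating_sum f es)"
proof -
  obtain p where p: "p 0 = u" "p n = u" "\<forall>i<n. {p i, p (Suc i)} \<in> E"
      "s = - ((-1) ^ n * (\<Sum>i<n. (-1) ^ i * f {p i, p (Suc i)}))"
    using walk_vertices[OF assms(1)] by blast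
  define vs where "vs = map p [0..<n]"
  define es where "es = map (\<lambda>i. {p i, p (Suc i)}) [0..<n]"
  \<comment> \<open>For \<open>i = n - 1\<close> the index wraps to 0, where
    \<open>p 0 = u = p n\<close>.\<close>
  have "vs ! (Suc i mod n) = p (Suc i)" if "i < n" for i
    using that p(1,2) by (cases "Suc i = n") (auto simp: vs_def)
  moreover have "p i \<in> V" if "i < n" for i
  proof -
    have "{p i, p (Suc i)} \<in> {{u, v} | u v. u \<in> V \<and> v \<in> V}"
      using p(3) that assms(3) by blast
    then show ?thesis
      by (auto simp: doubleton_eq_iff)
  qed
  ultimately have "is_cycle V E vs es"
    using p(3) assms(2) by (auto simp: is_cycle_def vs_def es_def)
  moreover have "s = - ((-1) ^ n * alternating_sum f es)"
    using p(4) by (simp add: alternating_sum_def es_def)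
  moreover have "length es = n"
    by (simp add: es_def)
  ultimately show ?thesis
    by blast
qed

lemma compatible_imp_additive:
  assumes "d > 0" and E: "E \<subseteq> {{u, v} | u v. u \<in> V \<and> v \<in> V}" and "compatible d V E fE"
  shows "additive d V E fE"
proof -
  have closed_even: "[s = 0] (mod d)" if closed: "walk E fE u n s u" and "even n" for u n s
  proof (cases "n = 0")
    case True
    with that(1) show ?thesis by (auto elim: walk.cases)
  next
    case False
    then obtain vs es where "is_cycle V E vs es" "length es = n"
        "s = - ((-1) ^ n * alternating_sum fE es)"
      using closed_walk_cycle[OF closed _ E] by auto
    then show ?thesis
      using assms(3) that(2) by (auto simp: compatible_def even_cycle_property_iff cong_0_iff)
  qed
  have closed_odd: "even s" if closed: "walk E fE u n s u" "odd n" and "even d" for u n s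
  proof -
    obtain vs es where "is_cycle V E vs es" "length es = n"
        "s = - ((-1) ^ n * alternating_sum fE es)"
      using closed_walk_cycle[OF closed(1) _ E] closed(2) by (auto simp: odd_pos)
    then show ?thesis
      using assms(1,3) that(2,3) by (auto simp: compatible_def odd_cycle_property_iff)
  qed
  have "\<exists>a. \<forall>n s. walk E fE r n s r \<and> odd n \<longrightarrow> [2 * a = s] (mod d)" for r
  proof (cases "\<exists>n s. walk E fE r n s r \<and> odd n")
    case True
    then obtain n s where ns: "walk E fE r n s r" "odd n"
      by blast
    \<comment> \<open>One odd closed walk fixes \<open>a\<close>: half of the even number
      \<open>s\<close> if \<open>d\<close> is even, \<open>s\<close> times an inverse of 2 if
      \<open>d\<close> is odd.\<close>
    obtain a where "[2 * a = s] (mod d)"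
    proof (cases "even d")
      case True
      with closed_odd[OF ns] that show ?thesis
        by (metis cong_refl evenE)
    next
      case False
      then have "coprime 2 d" by simp
      then show ?thesis
        using that cong_solve_coprime_int[of 2 d]
        by (metis cong_scalar_right mult.assoc mult_1)
    qed
    \<comment> \<open>Two odd closed walks at \<open>r\<close> concatenate to an even one with sum
      \<open>t - s\<close>.\<close>
    moreover have "[s = t] (mod d)" if "walk E fE r m t r" "odd m" for m t
      using closed_even[OF walk_append[OF that(1) ns(1)]] that(2) ns(2)
      by (simp add: cong_diff_iff_cong_0 cong_sym)
    ultimately show ?thesis
      by (meson cong_trans)
  qed blast
  then obtain a where a: "[2 * a r = s] (mod d)" if "walk E fE r n s r" "odd n" for r n s
    by metis
  have path_independent: "[s + (-1) ^ n * a r = t + (-1) ^ m * a r] (mod d)"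
    if "walk E fE r n s v" "walk E fE r m t v" for r v n s m t
  proof -
    \<comment> \<open>Out along the first walk and back along the second. If \<open>n + m\<close> is
      even, \<open>s\<close> and \<open>t\<close> agree modulo \<open>d\<close>; if it is odd, the
      choice of \<open>a r\<close> makes \<open>s - t\<close> congruent to
      \<open>2 * (-1) ^ m * a r\<close>.\<close>
    have closed: "walk E fE r (n + m) (- ((-1) ^ m * t) + (-1) ^ m * s) r"
      using walk_append[OF walk_reverse[OF that(2)] that(1)] .
    show ?thesis
    proof (cases "even (n + m)")
      case True
      with closed_even[OF closed] show ?thesis
        by (cases "even m") (auto simp: cong_iff_dvd_diff dvd_diff_commute)
    next
      case False
      from a[OF closed False] False show ?thesis
        by (cases "even m") (auto simp: cong_iff_dvd_diff algebra_simps dvd_diff_commute)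
    qed
  qed
  \<comment> \<open>Adjacent vertices are reached from the same vertices, so \<open>SOME\<close>
    picks one root for a whole component.\<close>
  define root where "root v = (SOME r. \<exists>n s. walk E fE r n s v)" for v
  have root: "\<exists>n s. walk E fE (root v) n s v" for v
    unfolding root_def by (rule someI[of _ v]) (blast intro: walk.nil)
  then obtain N S where NS: "walk E fE (root v) (N v) (S v) v" for v
    by metis
  have root_eq: "root u = root v" if "{u, v} \<in> E" for u v
  proof -
    have "{v, u} \<in> E" using that by (simp add: insert_commute)
    with that have "(\<exists>n s. walk E fE r n s u) \<longleftrightarrow> (\<exists>n s. walk E fE r n s v)" for r
      by (blast intro: walk.snoc)
    then show ?thesis by (simp add: root_def)
  qed
  define x where "x v = S v + (-1) ^ N v * a (root v)" for v
  have "[fE {u, v} = x u + x v] (mod d)" if "{u, v} \<in> E" for u v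
  proof -
    \<comment> \<open>The walk chosen for \<open>u\<close>, prolonged by the edge, competes with the
      one chosen for \<open>v\<close>; it assigns \<open>fE {u, v} - x u\<close> to
      \<open>v\<close>.\<close>
    have "walk E fE (root v) (Suc (N u)) (fE {u, v} - S u) v"
      using walk.snoc[OF NS that] root_eq[OF that] by simp
    from path_independent[OF this NS] show ?thesis
      by (simp add: x_def root_eq[OF that] cong_iff_dvd_diff algebra_simps)
  qed
  then have "valid_v_labeling d V E fE (\<lambda>v. x v mod d)"
    using assms(1) by (auto simp: valid_v_labeling_def v_labeling_def cong_def mod_add_eq)
  then show ?thesis
    by (auto simp: additive_def)
qed

theorem theorem1:
  fixes d :: int and V :: "'v set" and E :: "'v set set" and fE :: "'v set \<Rightarrow> int"
  assumes "d > 0"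
    and "finite_graph V E"
    and "e_labeling d E fE"
  shows "additive d V E fE \<longleftrightarrow> compatible d V E fE"
  using assms(1,2) additive_imp_compatible compatible_imp_additive
  unfolding finite_graph_def by blast

end
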